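(* Let $r\geq 3$ and let $k,n$ be positive integers with $k\le n$ and $n\geq 2k-1$. Label the primitive idempotents of the non-binary Johnson scheme $J_r(k,n)$ as $E_{ij}$, $(i,j)\in\mathcal{D}^\star:=\mathcal{D}$, so that $E_{ij}=\frac{1}{|S|}\sum_{(x,y)\in\mathcal{D}} q_{ij}(x,y)\,A_{xy}$ with $q_{ij}(x,y)=\frac{\binom{n}{i}}{\binom{k}{i}}K_i(x,k-y,r-1)\,H_j(y,n-i,k-i)$. Then, with this labeling, $J_r(k,n)$ is a bivariate $Q$-polynomial association scheme of type $(0,\tfrac12)$ on the region $\mathcal{D}^\star=\{(a,b)\in\mathbb{N}^2 : a+b\leq k,\ b\leq k,\ b\le n-k\}$; that is, $\mathcal{D}^\star$ is $(0,\tfrac12)$-compatible and for every $(i,j)\in\mathcal{D}^\star$ there is a $(0,\tfrac12)$-compatible bivariate polynomial $v^\star_{ij}(x,y)$ of degree $(i,j)$ such that $|S|\,E_{ij}=v^\star_{ij}(|S|E_{10},|S|E_{01})$, where products and powers of matrices are taken with respect to the Hadamard (entrywise) product (and the constant polynomial $1$ corresponds to the all-ones matrix).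
   Context: Non-binary Johnson scheme $J_r(k,n)$: let $r\ge 3$, $K=\{0,1,\dots,r-1\}$, and $S=\{\mathbf{x}\in K^n : w(\mathbf{x})=k\}$, where $w(\mathbf{x})$ is the number of nonzero components of $\mathbf{x}$. For $\mathbf{x},\mathbf{y}\in S$ let $e(\mathbf{x},\mathbf{y})=|\{i:\mathbf{x}_i=\mathbf{y}_i\neq 0\}|$ and $c(\mathbf{x},\mathbf{y})=|\{i:\mathbf{x}_i\ne0,\mathbf{y}_i\neq 0\}|$. For $(i,j)\in\mathcal{D}=\{(a,b)\in\mathbb{N}^2: a+b\le k,\ b\le k,\ b\le n-k\}$ let $R_{ij}=\{(\mathbf{x},\mathbf{y})\in S^2: e(\mathbf{x},\mathbf{y})=k-i-j,\ c(\mathbf{x},\mathbf{y})=k-j\}$ and let $A_{ij}$ be the $|S|\times|S|$ 0/1 adjacency matrix of $R_{ij}$; these form a symmetric commutative association scheme, and its primitive idempotents (orthogonal projections onto the common eigenspaces) are the matrices $E_{ij}$ above. Polynomials (binomial coefficients are generalized: $\binom{a}{b}=a(a-1)\cdots(a-b+1)/b!$ for integers $b\ge0$, and $0$ for $b<0$): Krawtchouk $K_i(x,N,p)=\sum_{\ell=0}^i(-1)^\ell(p-1)^{i-\ell}\binom{x}{\ell}\binom{N-x}{i-\ell}$; Eberlein $E_i(x,N,p)=\sum_{\ell=0}^i(-1)^\ell\binom{x}{\ell}\binom{p-x}{i-\ell}\binom{N-p-x}{i-\ell}$; Hahn $H_i(x,N,p)=\frac{\binom{N}{i}-\binom{N}{i-1}}{\binom{p}{x}\binom{N-p}{x}}E_x(i,N,p)$.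 Orders: for $0\le\alpha\le1$, $0\le\beta<1$, define $x^my^{n'}\preceq_{(\alpha,\beta)}x^iy^j$ (equivalently $(m,n')\preceq_{(\alpha,\beta)}(i,j)$ on $\mathbb{N}^2$) iff $m+\alpha n'\le i+\alpha j$ and $\beta m+n'\le\beta i+j$. A bivariate polynomial is $(\alpha,\beta)$-compatible of degree $(i,j)$ if the monomial $x^iy^j$ appears in it and every other monomial appearing is $\preceq_{(\alpha,\beta)}x^iy^j$. A subset $\mathcal{D}'\subseteq\mathbb{N}^2$ is $(\alpha,\beta)$-compatible if $(i,j)\in\mathcal{D}'$ and $(m,n')\preceq_{(\alpha,\beta)}(i,j)$ imply $(m,n')\in\mathcal{D}'$. *)

theory Defs
  imports Complex_Main "HOL-Library.FuncSet" "HOL-Computational_Algebra.Polynomial"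
begin

section \<open>Symmetric association schemes and their primitive idempotents\<close>

text \<open>
  A family of relations \<open>R d\<close> on \<open>X\<close>, indexed by \<open>d \<in> I\<close>. Symmetry of the relations makes the
  intersection numbers satisfy \<open>p\<^bsub>ab\<^esub>\<^sup>c = p\<^bsub>ba\<^esub>\<^sup>c\<close>, so the scheme is automatically commutative.
\<close>

definition symmetric_association_scheme ::
    "'a set \<Rightarrow> 'i set \<Rightarrow> ('i \<Rightarrow> ('a \<times> 'a) set) \<Rightarrow> bool" where
  "symmetric_association_scheme X I R \<longleftrightarrow>
     finite X \<and> X \<noteq> {} \<and> finite I \<and>
     (\<Union>d\<in>I. R d) = X \<times> X \<and>
     (\<forall>d\<in>I. R d \<noteq> {}) \<and>
     (\<forall>d\<in>I. \<forall>d'\<in>I. d \<noteq> d' \<longrightarrow> R d \<inter> R d' = {}) \<and>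
     (\<exists>d\<in>I. R d = Id_on X) \<and>
     (\<forall>d\<in>I. sym (R d)) \<and>
     (\<forall>a\<in>I. \<forall>b\<in>I. \<forall>c\<in>I. \<exists>p::nat. \<forall>(x, y)\<in>R c.
        card {z \<in> X. (x, z) \<in> R a \<and> (z, y) \<in> R b} = p)"

text \<open>
  An \<open>|X| \<times> |X|\<close> real matrix is a function of two arguments that vanishes outside \<open>X \<times> X\<close>, and a
  vector indexed by \<open>X\<close> is a function that vanishes outside \<open>X\<close>; equality of functions is then
  equality of matrices and vectors.
\<close>

definition adjacency :: "('i \<Rightarrow> ('a \<times> 'a) set) \<Rightarrow> 'i \<Rightarrow> 'a \<Rightarrow> 'a \<Rightarrow> real" where
  "adjacency R d x y = (if (x, y) \<in> R d then 1 else 0)"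

definition vecs_on :: "'a set \<Rightarrow> ('a \<Rightarrow> real) set" where
  "vecs_on X = {v. \<forall>x. x \<notin> X \<longrightarrow> v x = 0}"

definition mats_on :: "'a set \<Rightarrow> ('a \<Rightarrow> 'a \<Rightarrow> real) set" where
  "mats_on X = {M. \<forall>x y. \<not> (x \<in> X \<and> y \<in> X) \<longrightarrow> M x y = 0}"

definition mat_vec :: "'a set \<Rightarrow> ('a \<Rightarrow> 'a \<Rightarrow> real) \<Rightarrow> ('a \<Rightarrow> real) \<Rightarrow> 'a \<Rightarrow> real" where
  "mat_vec X M v = (\<lambda>x. \<Sum>y\<in>X. M x y * v y)"

definition mat_mult ::
    "'a set \<Rightarrow> ('a \<Rightarrow> 'a \<Rightarrow> real) \<Rightarrow> ('a \<Rightarrow> 'a \<Rightarrow> real) \<Rightarrow> 'a \<Rightarrow> 'a \<Rightarrow> real" where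
  "mat_mult X M N = (\<lambda>x y. \<Sum>z\<in>X. M x z * N z y)"

definition common_eigenspace ::
    "'a set \<Rightarrow> 'i set \<Rightarrow> ('i \<Rightarrow> 'a \<Rightarrow> 'a \<Rightarrow> real) \<Rightarrow> ('i \<Rightarrow> real) \<Rightarrow> ('a \<Rightarrow> real) set" where
  "common_eigenspace X I A \<theta> =
     {v \<in> vecs_on X. \<forall>d\<in>I. mat_vec X (A d) v = (\<lambda>x. \<theta> d * v x)}"

definition orthogonal_projection_onto ::
    "'a set \<Rightarrow> ('a \<Rightarrow> real) set \<Rightarrow> ('a \<Rightarrow> 'a \<Rightarrow> real) \<Rightarrow> bool" where
  "orthogonal_projection_onto X V M \<longleftrightarrow>
     M \<in> mats_on X \<and> (\<forall>x y. M x y = M y x) \<and> mat_mult X M M = M \<and>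
     mat_vec X M ` vecs_on X = V"

definition primitive_idempotents ::
    "'a set \<Rightarrow> 'i set \<Rightarrow> ('i \<Rightarrow> ('a \<times> 'a) set) \<Rightarrow> ('a \<Rightarrow> 'a \<Rightarrow> real) set" where
  "primitive_idempotents X I R =
     {M. \<exists>\<theta>. common_eigenspace X I (adjacency R) \<theta> \<noteq> {\<lambda>x. 0} \<and>
             orthogonal_projection_onto X (common_eigenspace X I (adjacency R) \<theta>) M}"

section \<open>The bivariate Q-polynomial property\<close>

definition prec_order :: "real \<Rightarrow> real \<Rightarrow> nat \<times> nat \<Rightarrow> nat \<times> nat \<Rightarrow> bool" where
  "prec_order \<alpha> \<beta> = (\<lambda>(m, n) (i, j).
     real m + \<alpha> * real n \<le> real i + \<alpha> * real j \<and> \<beta> * real m + real n \<le> \<beta> * real i + real j)"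

definition compatible_region :: "real \<Rightarrow> real \<Rightarrow> (nat \<times> nat) set \<Rightarrow> bool" where
  "compatible_region \<alpha> \<beta> D \<longleftrightarrow> (\<forall>d\<in>D. \<forall>d'. prec_order \<alpha> \<beta> d' d \<longrightarrow> d' \<in> D)"

text \<open>
  A bivariate polynomial is an element of \<open>\<real>[y][x]\<close>: the coefficient of \<open>x\<^sup>m y\<^sup>n\<close> in \<open>v\<close> is
  \<open>coeff (coeff v m) n\<close>.
\<close>

definition coeff2 :: "real poly poly \<Rightarrow> nat \<times> nat \<Rightarrow> real" where
  "coeff2 v = (\<lambda>(m, n). coeff (coeff v m) n)"

definition eval2 :: "real poly poly \<Rightarrow> real \<Rightarrow> real \<Rightarrow> real" where
  "eval2 v a b = poly (poly v [:a:]) b"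

definition compatible_poly :: "real \<Rightarrow> real \<Rightarrow> nat \<times> nat \<Rightarrow> real poly poly \<Rightarrow> bool" where
  "compatible_poly \<alpha> \<beta> d v \<longleftrightarrow>
     coeff2 v d \<noteq> 0 \<and> (\<forall>d'. d' \<noteq> d \<and> coeff2 v d' \<noteq> 0 \<longrightarrow> prec_order \<alpha> \<beta> d' d)"

text \<open>
  Evaluating a polynomial at matrices with respect to the Hadamard product means evaluating it
  entrywise, for all entries indexed by \<open>X \<times> X\<close>; the constant \<open>1\<close> becomes the all-ones matrix.
\<close>

definition bivariate_Q_polynomial ::
    "real \<Rightarrow> real \<Rightarrow> 'a set \<Rightarrow> 'i set \<Rightarrow> ('i \<Rightarrow> ('a \<times> 'a) set) \<Rightarrow>
     (nat \<times> nat) set \<Rightarrow> (nat \<times> nat \<Rightarrow> 'a \<Rightarrow> 'a \<Rightarrow> real) \<Rightarrow> bool" where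
  "bivariate_Q_polynomial \<alpha> \<beta> X I R Dstar E \<longleftrightarrow>
     0 \<le> \<alpha> \<and> \<alpha> \<le> 1 \<and> 0 \<le> \<beta> \<and> \<beta> < 1 \<and>
     symmetric_association_scheme X I R \<and>
     bij_betw E Dstar (primitive_idempotents X I R) \<and>
     compatible_region \<alpha> \<beta> Dstar \<and>
     (\<forall>d\<in>Dstar. \<exists>v. compatible_poly \<alpha> \<beta> d v \<and>
        (\<forall>x\<in>X. \<forall>y\<in>X. real (card X) * E d x y =
           eval2 v (real (card X) * E (1, 0) x y) (real (card X) * E (0, 1) x y)))"

section \<open>The non-binary Johnson scheme\<close>

definition weight :: "nat \<Rightarrow> (nat \<Rightarrow> nat) \<Rightarrow> nat" where
  "weight n x = card {i. i < n \<and> x i \<noteq> 0}"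

definition johnson_points :: "nat \<Rightarrow> nat \<Rightarrow> nat \<Rightarrow> (nat \<Rightarrow> nat) set" where
  "johnson_points r k n = {x \<in> {..<n} \<rightarrow>\<^sub>E {..<r}. weight n x = k}"

definition equal_nonzero :: "nat \<Rightarrow> (nat \<Rightarrow> nat) \<Rightarrow> (nat \<Rightarrow> nat) \<Rightarrow> nat" where
  "equal_nonzero n x y = card {i. i < n \<and> x i = y i \<and> y i \<noteq> 0}"

definition common_nonzero :: "nat \<Rightarrow> (nat \<Rightarrow> nat) \<Rightarrow> (nat \<Rightarrow> nat) \<Rightarrow> nat" where
  "common_nonzero n x y = card {i. i < n \<and> x i \<noteq> 0 \<and> y i \<noteq> 0}"

definition johnson_region :: "nat \<Rightarrow> nat \<Rightarrow> (nat \<times> nat) set" where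
  "johnson_region k n = {(a, b). a + b \<le> k \<and> b \<le> k \<and> b \<le> n - k}"

definition johnson_rel ::
    "nat \<Rightarrow> nat \<Rightarrow> nat \<Rightarrow> nat \<times> nat \<Rightarrow> ((nat \<Rightarrow> nat) \<times> (nat \<Rightarrow> nat)) set" where
  "johnson_rel r k n = (\<lambda>(i, j).
     {(x, y). x \<in> johnson_points r k n \<and> y \<in> johnson_points r k n \<and>
              equal_nonzero n x y = k - i - j \<and> common_nonzero n x y = k - j})"

definition krawtchouk :: "nat \<Rightarrow> real \<Rightarrow> real \<Rightarrow> real \<Rightarrow> real" where
  "krawtchouk i x N p =
     (\<Sum>l=0..i. (-1) ^ l * (p - 1) ^ (i - l) * (x gchoose l) * ((N - x) gchoose (i - l)))"

definition eberlein :: "nat \<Rightarrow> real \<Rightarrow> real \<Rightarrow> real \<Rightarrow> real" where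
  "eberlein i x N p =
     (\<Sum>l=0..i. (-1) ^ l * (x gchoose l) * ((p - x) gchoose (i - l)) * ((N - p - x) gchoose (i - l)))"

definition hahn :: "nat \<Rightarrow> nat \<Rightarrow> real \<Rightarrow> real \<Rightarrow> real" where
  "hahn i x N p =
     ((N gchoose i) - (if i = 0 then 0 else N gchoose (i - 1))) /
     ((p gchoose x) * ((N - p) gchoose x)) * eberlein x (real i) N p"

text \<open>
  For \<open>(i, j)\<close> and \<open>(x, y)\<close> in the region with \<open>y > k - i\<close>, the Hahn factor is the indeterminate
  \<open>0 / 0\<close> (which is \<open>0\<close> in HOL), but there the Krawtchouk factor is \<open>0\<close>, so the product is \<open>0\<close>
  under any convention.
\<close>

definition johnson_q :: "nat \<Rightarrow> nat \<Rightarrow> nat \<Rightarrow> nat \<times> nat \<Rightarrow> nat \<times> nat \<Rightarrow> real" where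
  "johnson_q r k n = (\<lambda>(i, j) (x, y).
     (real n gchoose i) / (real k gchoose i) *
     krawtchouk i (real x) (real k - real y) (real r - 1) *
     hahn j y (real n - real i) (real k - real i))"

end

theory Submission
  imports Defs
    "HOL-Computational_Algebra.Formal_Power_Series"
    "HOL-Combinatorics.Permutations"
begin

text \<open>
  Permuting the coordinates and, in every coordinate, the nonzero symbols acts transitively on each
  relation, which gives the intersection numbers. On the region, \<open>q\<^bsub>10\<^esub>\<close> is proportional to
  \<open>X = (r - 2) (k - y) - (r - 1) x\<close> and \<open>q\<^bsub>01\<^esub>\<close> is a nonconstant affine function of \<open>y\<close>. The three-term
  recurrence of the Krawtchouk polynomials shows that \<open>K\<^sub>i(x, k - y, r - 1)\<close> is a polynomial in \<open>X\<close> and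
  \<open>y\<close> with leading monomial \<open>X\<^sup>i\<close> in which \<open>y\<close> counts twice towards the degree, and the Hahn factor is a
  polynomial of degree \<open>j\<close> in \<open>y\<close>. Hence \<open>q\<^bsub>ij\<^esub>\<close> contains \<open>X\<^sup>i y\<^sup>j\<close>, and every monomial
  \<open>X\<^sup>m y\<^sup>s\<close> in it satisfies \<open>m \<le> i\<close> and \<open>m + 2 s \<le> i + 2 j\<close>, which is the order of type \<open>(0, 1/2)\<close>.
\<close>

section \<open>The association scheme\<close>

lemma finite_johnson_points: "finite (johnson_points r k n)"
  unfolding johnson_points_def
  by (rule finite_subset[of _ "{..<n} \<rightarrow>\<^sub>E {..<r}"]) (auto intro: finite_PiE)

lemma finite_johnson_region: "finite (johnson_region k n)"
  by (rule finite_subset[of _ "{..k} \<times> {..k}"]) (auto simp: johnson_region_def)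

lemma johnson_rel_nonempty:
  assumes "r \<ge> 3" "k \<le> n" "d \<in> johnson_region k n"
  shows "johnson_rel r k n d \<noteq> {}"
proof -
  obtain i j where d: "d = (i, j)" "i + j \<le> k" "j \<le> n - k"
    using assms by (auto simp: johnson_region_def)
  \<comment> \<open>Against \<open>x\<close>, the word \<open>y\<close> agrees on
    \<open>k - i - j\<close> coordinates, differs on \<open>i\<close> (the symbol 2 requires
    \<open>r \<ge> 3\<close>) and is zero on \<open>j\<close>; the lost weight is restored by
    \<open>j\<close> ones beyond the support of \<open>x\<close>, where \<open>j \<le> n - k\<close>
    leaves room.\<close>
  define x where "x = (\<lambda>l\<in>{..<n}. if l < k then 1 else 0 :: nat)"
  define y where "y = (\<lambda>l\<in>{..<n}. if l < k - i - j then 1 else if l < k - j then 2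
     else if k \<le> l \<and> l < k + j then 1 else 0 :: nat)"
  have "{l. l < n \<and> x l \<noteq> 0} = {..<k}" using assms by (auto simp: x_def)
  then have wx: "weight n x = k" by (simp add: weight_def)
  have "{l. l < n \<and> y l \<noteq> 0} = {..<k - j} \<union> {k..<k + j}" using assms d by (auto simp: y_def)
  moreover have "card ({..<k - j} \<union> {k..<k + j}) = k"
    using d by (subst card_Un_disjoint) auto
  ultimately have wy: "weight n y = k" by (simp add: weight_def)
  have "{l. l < n \<and> x l = y l \<and> y l \<noteq> 0} = {..<k - i - j}"
    using assms d by (auto simp: x_def y_def split: if_splits)
  moreover have "{l. l < n \<and> x l \<noteq> 0 \<and> y l \<noteq> 0} = {..<k - j}"
    using assms d by (auto simp: x_def y_def split: if_splits)
  ultimately have "(x, y) \<in> johnson_rel r k n d"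
    using wx wy assms(1)
    by (auto simp: d johnson_rel_def johnson_points_def equal_nonzero_def common_nonzero_def x_def y_def)
  then show ?thesis by blast
qed

lemma equal_nonzero_commute: "equal_nonzero n x y = equal_nonzero n y x"
  unfolding equal_nonzero_def by (rule arg_cong[of _ _ card]) auto

lemma common_nonzero_commute: "common_nonzero n x y = common_nonzero n y x"
  unfolding common_nonzero_def by (rule arg_cong[of _ _ card]) auto

text \<open>The last bound is inclusion-exclusion: the union of the two supports has at most
  \<open>n\<close> elements.\<close>

lemma common_nonzero_bounds:
  assumes x: "weight n x = k" and y: "weight n y = k"
  shows "equal_nonzero n x y \<le> common_nonzero n x y" "common_nonzero n x y \<le> k"
    "2 * k \<le> n + common_nonzero n x y"
proof -
  show "equal_nonzero n x y \<le> common_nonzero n x y"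
    unfolding equal_nonzero_def common_nonzero_def by (rule card_mono) auto
  show "common_nonzero n x y \<le> k"
    unfolding common_nonzero_def x[symmetric] weight_def by (rule card_mono) auto
  define S T where "S = {i. i < n \<and> x i \<noteq> 0}" and "T = {i. i < n \<and> y i \<noteq> 0}"
  have "card (S \<union> T) \<le> card {..<n}" by (rule card_mono) (auto simp: S_def T_def)
  moreover have "card (S \<inter> T) = common_nonzero n x y"
    unfolding common_nonzero_def by (rule arg_cong[of _ _ card]) (auto simp: S_def T_def)
  moreover have "card S + card T = card (S \<union> T) + card (S \<inter> T)"
    by (rule card_Un_Int) (auto simp: S_def T_def)
  ultimately show "2 * k \<le> n + common_nonzero n x y"
    using x y by (simp add: weight_def S_def T_def)
qed

lemma johnson_rel_cover:
  assumes "k \<le> n" "x \<in> johnson_points r k n" "y \<in> johnson_points r k n"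
  obtains d where "d \<in> johnson_region k n" "(x, y) \<in> johnson_rel r k n d"
proof
  have w: "weight n x = k" "weight n y = k" using assms by (auto simp: johnson_points_def)
  let ?d = "(common_nonzero n x y - equal_nonzero n x y, k - common_nonzero n x y)"
  show "?d \<in> johnson_region k n" "(x, y) \<in> johnson_rel r k n ?d"
    using common_nonzero_bounds[OF w] assms
    by (auto simp: johnson_region_def johnson_rel_def)
qed

text \<open>On the region \<open>k - i - j\<close> and \<open>k - j\<close> do not truncate, so the
  two counts recover \<open>j\<close> and then \<open>i\<close>.\<close>

lemma johnson_rel_unique:
  assumes "d \<in> johnson_region k n" "d' \<in> johnson_region k n"
    "(x, y) \<in> johnson_rel r k n d" "(x, y) \<in> johnson_rel r k n d'"
  shows "d = d'"
  using assms by (auto simp: johnson_region_def johnson_rel_def)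

lemma johnson_rel_0: "johnson_rel r k n (0, 0) = Id_on (johnson_points r k n)"
proof -
  have "x = y" if x: "x \<in> johnson_points r k n" and y: "y \<in> johnson_points r k n"
    and e: "equal_nonzero n x y = k" for x y
  proof -
    have w: "weight n x = k" "weight n y = k" using x y by (simp_all add: johnson_points_def)
    \<comment> \<open>The positions of agreement lie in both supports and number \<open>k\<close>,
      so they fill both; elsewhere both words are 0.\<close>
    have 1: "{i. i < n \<and> x i = y i \<and> y i \<noteq> 0} = {i. i < n \<and> x i \<noteq> 0}"
    proof (rule card_subset_eq)
      show "card {i. i < n \<and> x i = y i \<and> y i \<noteq> 0} = card {i. i < n \<and> x i \<noteq> 0}"
        using w(1) e by (simp add: weight_def equal_nonzero_def)
    qed auto
    have 2: "{i. i < n \<and> x i = y i \<and> y i \<noteq> 0} = {i. i < n \<and> y i \<noteq> 0}"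
    proof (rule card_subset_eq)
      show "card {i. i < n \<and> x i = y i \<and> y i \<noteq> 0} = card {i. i < n \<and> y i \<noteq> 0}"
        using w(2) e by (simp add: weight_def equal_nonzero_def)
    qed auto
    show ?thesis
    proof (rule extensionalityI[of _ "{..<n}"])
      show "x i = y i" if "i \<in> {..<n}" for i
      proof (cases "x i = 0 \<and> y i = 0")
        case False
        then have "i \<in> {i. i < n \<and> x i = y i \<and> y i \<noteq> 0}"
          using that 1 2 by (cases "x i = 0") blast+
        then show ?thesis by simp
      qed simp
    qed (use x y in \<open>auto simp: johnson_points_def PiE_def\<close>)
  qed
  moreover have "equal_nonzero n x x = k" "common_nonzero n x x = k" if "x \<in> johnson_points r k n" for x
    using that by (simp_all add: johnson_points_def equal_nonzero_def common_nonzero_def weight_def)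
  ultimately show ?thesis by (auto simp: johnson_rel_def)
qed

section \<open>Transitivity on each relation and the intersection numbers\<close>

text \<open>The first swap moves \<open>a\<close> to \<open>a'\<close>, the second moves the image
  \<open>b1\<close> of \<open>b\<close> to \<open>b'\<close>. By the equivalences assumed,
  \<open>b1 = a'\<close> exactly when \<open>b' = a'\<close>, and likewise for 0, so the second swap
  leaves \<open>a'\<close> and 0 in place.\<close>

lemma exists_symbol_permutation:
  fixes a b a' b' :: nat
  assumes "a < r" "b < r" "a' < r" "b' < r"
    "a \<noteq> 0 \<longleftrightarrow> a' \<noteq> 0" "b \<noteq> 0 \<longleftrightarrow> b' \<noteq> 0" "a = b \<longleftrightarrow> a' = b'"
  shows "\<exists>\<pi>. \<pi> permutes {..<r} \<and> \<pi> 0 = 0 \<and> \<pi> a = a' \<and> \<pi> b = b'"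
proof (intro exI conjI)
  define b1 where "b1 = transpose a a' b"
  let ?\<pi> = "transpose b1 b' \<circ> transpose a a'"
  have b1: "b1 = 0 \<longleftrightarrow> b' = 0" "b1 = a' \<longleftrightarrow> b' = a'" "b1 < r"
    using assms by (auto simp: b1_def transpose_def)
  show "?\<pi> permutes {..<r}"
    using assms b1 by (intro permutes_compose permutes_swap_id) auto
  have "transpose a a' 0 = 0" using assms(5) by (cases "a = 0") simp_all
  then show "?\<pi> 0 = 0" using b1(1) by (cases "b1 = 0") simp_all
  show "?\<pi> a = a'" using b1(2) by (cases "b1 = a'") simp_all
  show "?\<pi> b = b'" by (simp add: b1_def)
qed

text \<open>The number of coordinates of each type depends only on \<open>n\<close>,
  \<open>k\<close> and the two counts. Five of the eight truth triples are consistent; the others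
  have count 0.\<close>

lemma card_coordinate_type:
  assumes x: "weight n x = k" and y: "weight n y = k"
  shows "card {i \<in> {..<n}. (x i \<noteq> 0, y i \<noteq> 0, x i = y i) = v} =
    (if v = (True, True, True) then equal_nonzero n x y
     else if v = (True, True, False) then common_nonzero n x y - equal_nonzero n x y
     else if v = (True, False, False) \<or> v = (False, True, False) then k - common_nonzero n x y
     else if v = (False, False, True) then n + common_nonzero n x y - 2 * k else 0)"
proof -
  define S T W where "S = {i. i < n \<and> x i \<noteq> 0}" and "T = {i. i < n \<and> y i \<noteq> 0}"
    and "W = {i. i < n \<and> x i = y i \<and> y i \<noteq> 0}"
  have fin: "finite S" "finite T" "finite W" by (auto simp: S_def T_def W_def)
  have cS: "card S = k" and cT: "card T = k" and cW: "card W = equal_nonzero n x y"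
    using x y by (auto simp: S_def T_def W_def weight_def equal_nonzero_def)
  have ST: "card (S \<inter> T) = common_nonzero n x y"
    unfolding common_nonzero_def by (rule arg_cong[of _ _ card]) (auto simp: S_def T_def)
  have "card S + card T = card (S \<union> T) + card (S \<inter> T)" by (rule card_Un_Int) (fact fin)+
  then have U: "card (S \<union> T) = 2 * k - common_nonzero n x y" using cS cT ST by simp
  have "card (S \<inter> T - W) = common_nonzero n x y - equal_nonzero n x y"
    using fin by (subst card_Diff_subset) (auto simp: ST cW, auto simp: S_def T_def W_def)
  moreover have "card (S - S \<inter> T) = k - common_nonzero n x y"
    using fin by (subst card_Diff_subset) (auto simp: ST cS)
  moreover have "card (T - S \<inter> T) = k - common_nonzero n x y"
    using fin by (subst card_Diff_subset) (auto simp: ST cT)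
  moreover have "card ({..<n} - (S \<union> T)) = n + common_nonzero n x y - 2 * k"
    using fin common_nonzero_bounds[OF x y]
    by (subst card_Diff_subset) (auto simp: U, auto simp: S_def T_def)
  moreover have "{i \<in> {..<n}. (x i \<noteq> 0, y i \<noteq> 0, x i = y i) = v} =
    (if v = (True, True, True) then W else if v = (True, True, False) then S \<inter> T - W
     else if v = (True, False, False) then S - S \<inter> T
     else if v = (False, True, False) then T - S \<inter> T
     else if v = (False, False, True) then {..<n} - (S \<union> T) else {})"
    by (cases v) (auto simp: S_def T_def W_def)
  ultimately show ?thesis using cW by simp
qed

text \<open>Equal type counts give a coordinate permutation \<rho> matching types; a symbol
  permutation fixing 0 then adjusts each coordinate. Such a map preserves zeros and coordinatewise
  equality, hence both counts.\<close>

lemma johnson_transitive: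
  assumes x: "x \<in> johnson_points r k n" and y: "y \<in> johnson_points r k n"
    and x': "x' \<in> johnson_points r k n" and y': "y' \<in> johnson_points r k n"
    and e: "equal_nonzero n x y = equal_nonzero n x' y'"
    and c: "common_nonzero n x y = common_nonzero n x' y'"
  obtains \<phi> where "\<phi> x = x'" "\<phi> y = y'" "inj_on \<phi> (johnson_points r k n)"
    "\<phi> ` johnson_points r k n \<subseteq> johnson_points r k n"
    "\<And>z w. equal_nonzero n (\<phi> z) (\<phi> w) = equal_nonzero n z w"
    "\<And>z w. common_nonzero n (\<phi> z) (\<phi> w) = common_nonzero n z w"
proof -
  have w: "weight n x = k" "weight n y = k" "weight n x' = k" "weight n y' = k"
    and lt: "\<And>i. i < n \<Longrightarrow> x i < r" "\<And>i. i < n \<Longrightarrow> y i < r"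
      "\<And>i. i < n \<Longrightarrow> x' i < r" "\<And>i. i < n \<Longrightarrow> y' i < r"
    using x y x' y' by (auto simp: johnson_points_def PiE_iff)
  let ?t = "\<lambda>x y i. (x i \<noteq> 0, y i \<noteq> 0, x i = (y i :: nat))"
  have "image_mset (?t x' y') (mset_set {..<n}) = image_mset (?t x y) (mset_set {..<n})"
    by (rule multiset_eqI)
      (simp only: count_image_mset_eq_card_vimage finite_lessThan
        card_coordinate_type[OF w(1,2)] card_coordinate_type[OF w(3,4)] e c)
  then obtain \<rho> where \<rho>: "\<rho> permutes {..<n}" "\<forall>i\<in>{..<n}. ?t x' y' i = ?t x y (\<rho> i)"
    using image_mset_eq_implies_permutes[of "{..<n}"] by blast
  have \<rho>n: "\<rho> i < n \<longleftrightarrow> i < n" for i using permutes_in_image[OF \<rho>(1), of i] by simp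
  have "\<forall>i. \<exists>\<pi>. i < n \<longrightarrow> \<pi> permutes {..<r} \<and> \<pi> 0 = 0 \<and> \<pi> (x (\<rho> i)) = x' i \<and> \<pi> (y (\<rho> i)) = y' i"
  proof (intro allI)
    fix i
    show "\<exists>\<pi>. i < n \<longrightarrow> \<pi> permutes {..<r} \<and> \<pi> 0 = 0 \<and> \<pi> (x (\<rho> i)) = x' i \<and> \<pi> (y (\<rho> i)) = y' i"
    proof (cases "i < n")
      case True
      then show ?thesis
        using exists_symbol_permutation[of "x (\<rho> i)" r "y (\<rho> i)" "x' i" "y' i"] lt \<rho>(2) \<rho>n by auto
    qed simp
  qed
  then obtain \<pi> where \<pi>: "\<And>i. i < n \<Longrightarrow> \<pi> i permutes {..<r}" "\<And>i. i < n \<Longrightarrow> \<pi> i 0 = 0"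
    "\<And>i. i < n \<Longrightarrow> \<pi> i (x (\<rho> i)) = x' i" "\<And>i. i < n \<Longrightarrow> \<pi> i (y (\<rho> i)) = y' i"
    by metis
  define \<phi> where "\<phi> z = (\<lambda>i\<in>{..<n}. \<pi> i (z (\<rho> i)))" for z :: "nat \<Rightarrow> nat"
  have eq: "\<phi> z i = \<phi> w i \<longleftrightarrow> z (\<rho> i) = w (\<rho> i)" and zero: "\<phi> z i = 0 \<longleftrightarrow> z (\<rho> i) = 0"
    if "i < n" for z w i
  proof -
    have inj: "inj (\<pi> i)" using \<pi>(1)[OF that] by (rule permutes_inj)
    then show "\<phi> z i = \<phi> w i \<longleftrightarrow> z (\<rho> i) = w (\<rho> i)" using that by (auto simp: \<phi>_def inj_eq)
    show "\<phi> z i = 0 \<longleftrightarrow> z (\<rho> i) = 0"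
      using that inj_eq[OF inj, of "z (\<rho> i)" 0] \<pi>(2)[OF that] by (simp add: \<phi>_def)
  qed
  have card_\<rho>: "card {i. i < n \<and> Q (\<rho> i)} = card {i. i < n \<and> Q i}" for Q
  proof (rule bij_betw_same_card[of \<rho>])
    show "bij_betw \<rho> {i. i < n \<and> Q (\<rho> i)} {i. i < n \<and> Q i}"
      unfolding bij_betw_def
    proof
      show "inj_on \<rho> {i. i < n \<and> Q (\<rho> i)}" using permutes_inj_on[OF \<rho>(1)] .
      show "\<rho> ` {i. i < n \<and> Q (\<rho> i)} = {i. i < n \<and> Q i}"
        using permutes_surj[OF \<rho>(1)] \<rho>n by (auto simp: image_iff) (metis surjD)
    qed
  qed
  show thesis
  proof (rule that[of \<phi>])
    show "\<phi> x = x'"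
      by (rule extensionalityI[of _ "{..<n}"])
        (use x' \<pi>(3) in \<open>auto simp: \<phi>_def johnson_points_def PiE_def\<close>)
    show "\<phi> y = y'"
      by (rule extensionalityI[of _ "{..<n}"])
        (use y' \<pi>(4) in \<open>auto simp: \<phi>_def johnson_points_def PiE_def\<close>)
    show "inj_on \<phi> (johnson_points r k n)"
    proof (rule inj_onI)
      fix z w assume zw: "z \<in> johnson_points r k n" "w \<in> johnson_points r k n" "\<phi> z = \<phi> w"
      show "z = w"
      proof (rule extensionalityI[of _ "{..<n}"])
        fix i assume "i \<in> {..<n}"
        moreover obtain i' where "\<rho> i' = i" using permutes_surj[OF \<rho>(1)] by (metis surjD)
        ultimately show "z i = w i" using eq[of i' z w] zw(3) \<rho>n[of i'] by auto
      qed (use zw in \<open>auto simp: johnson_points_def PiE_def\<close>)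
    qed
    show en: "equal_nonzero n (\<phi> z) (\<phi> w) = equal_nonzero n z w" for z w
      unfolding equal_nonzero_def
      using card_\<rho>[of "\<lambda>i. z i = w i \<and> w i \<noteq> 0"] by (simp add: eq zero cong: conj_cong)
    show "common_nonzero n (\<phi> z) (\<phi> w) = common_nonzero n z w" for z w
      unfolding common_nonzero_def
      using card_\<rho>[of "\<lambda>i. z i \<noteq> 0 \<and> w i \<noteq> 0"] by (simp add: zero cong: conj_cong)
    show "\<phi> ` johnson_points r k n \<subseteq> johnson_points r k n"
    proof (intro image_subsetI)
      fix z assume z: "z \<in> johnson_points r k n"
      have "weight n (\<phi> z) = weight n z"
        unfolding weight_def using card_\<rho>[of "\<lambda>i. z i \<noteq> 0"] by (simp add: zero cong: conj_cong)
      moreover have "\<pi> i (z (\<rho> i)) < r" if "i < n" for i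
      proof -
        have "z (\<rho> i) < r" using z that \<rho>n by (auto simp: johnson_points_def PiE_iff)
        then show ?thesis using permutes_in_image[OF \<pi>(1)[OF that], of "z (\<rho> i)"] by simp
      qed
      ultimately show "\<phi> z \<in> johnson_points r k n"
        using z by (auto simp: johnson_points_def \<phi>_def)
    qed
  qed
qed

text \<open>The map from transitivity injects one set of intermediate points into the other.
  Exchanging the two pairs later turns this into equality.\<close>

lemma johnson_intersection_number_le:
  assumes "(x, y) \<in> johnson_rel r k n c" "(x', y') \<in> johnson_rel r k n c"
  shows "card {z \<in> johnson_points r k n. (x, z) \<in> johnson_rel r k n a \<and> (z, y) \<in> johnson_rel r k n b}
    \<le> card {z \<in> johnson_points r k n. (x', z) \<in> johnson_rel r k n a \<and> (z, y') \<in> johnson_rel r k n b}"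
proof -
  obtain \<phi> where \<phi>: "\<phi> x = x'" "\<phi> y = y'" "inj_on \<phi> (johnson_points r k n)"
    "\<phi> ` johnson_points r k n \<subseteq> johnson_points r k n"
    "\<And>z w. equal_nonzero n (\<phi> z) (\<phi> w) = equal_nonzero n z w"
    "\<And>z w. common_nonzero n (\<phi> z) (\<phi> w) = common_nonzero n z w"
    using assms johnson_transitive[of x r k n y x' y'] by (auto simp: johnson_rel_def split: prod.splits)
  have rel: "(\<phi> z, \<phi> w) \<in> johnson_rel r k n d" if "(z, w) \<in> johnson_rel r k n d" for z w d
    using that \<phi>(4-6) by (auto simp: johnson_rel_def)
  show ?thesis
  proof (rule card_inj_on_le[of \<phi>])
    show "inj_on \<phi> {z \<in> johnson_points r k n. (x, z) \<in> johnson_rel r k n a \<and> (z, y) \<in> johnson_rel r k n b}"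
      using \<phi>(3) by (rule inj_on_subset) auto
  qed (use rel[of x _ a] rel[of _ y b] \<phi>(1,2,4) finite_johnson_points[of r k n] in auto)
qed

lemma johnson_scheme:
  assumes "r \<ge> 3" "k \<le> n"
  shows "symmetric_association_scheme (johnson_points r k n) (johnson_region k n) (johnson_rel r k n)"
  unfolding symmetric_association_scheme_def
proof (intro conjI ballI impI)
  show "finite (johnson_points r k n)" by (rule finite_johnson_points)
  show "finite (johnson_region k n)" by (rule finite_johnson_region)
  have 0: "(0, 0) \<in> johnson_region k n" by (simp add: johnson_region_def)
  show "johnson_points r k n \<noteq> {}"
    using johnson_rel_nonempty[OF assms 0] unfolding johnson_rel_0 by auto
  show "(\<Union>d\<in>johnson_region k n. johnson_rel r k n d) = johnson_points r k n \<times> johnson_points r k n"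
    by (auto elim: johnson_rel_cover[OF assms(2)]) (auto simp: johnson_rel_def)
  show "johnson_rel r k n d \<noteq> {}" if "d \<in> johnson_region k n" for d
    using johnson_rel_nonempty[OF assms that] .
  show "johnson_rel r k n d \<inter> johnson_rel r k n d' = {}"
    if "d \<in> johnson_region k n" "d' \<in> johnson_region k n" "d \<noteq> d'" for d d'
    using johnson_rel_unique[OF that(1,2)] that(3) by (auto simp: disjoint_iff)
  show "\<exists>d\<in>johnson_region k n. johnson_rel r k n d = Id_on (johnson_points r k n)"
    using 0 johnson_rel_0 by blast
  show "sym (johnson_rel r k n d)" for d
    by (rule symI)
      (auto simp: johnson_rel_def equal_nonzero_commute common_nonzero_commute split: prod.splits)
  fix a b c
  show "\<exists>p::nat. \<forall>(x, y)\<in>johnson_rel r k n c.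
     card {z \<in> johnson_points r k n. (x, z) \<in> johnson_rel r k n a \<and> (z, y) \<in> johnson_rel r k n b} = p"
  proof (cases "johnson_rel r k n c = {}")
    case False
    then obtain x y where "(x, y) \<in> johnson_rel r k n c" by auto
    then show ?thesis
      by (intro exI[of _ "card {z \<in> johnson_points r k n. (x, z) \<in> johnson_rel r k n a \<and> (z, y) \<in> johnson_rel r k n b}"])
        (auto intro!: antisym johnson_intersection_number_le)
  qed auto
qed

section \<open>Weighted degrees of bivariate polynomials\<close>

text \<open>This is the order of type (0, 1/2) with its second inequality doubled. \<open>c\<close>
  may be 0: the predicate then only bounds the monomials, so that lower-order terms can be
  subtracted without changing a leading coefficient.\<close>

definition weight_bounded :: "nat \<Rightarrow> nat \<Rightarrow> real \<Rightarrow> real poly poly \<Rightarrow> bool" where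
  "weight_bounded i j c v \<longleftrightarrow> coeff2 v (i, j) = c \<and>
     (\<forall>m s. coeff2 v (m, s) \<noteq> 0 \<longrightarrow> m \<le> i \<and> m + 2 * s \<le> i + 2 * j)"

lemma weight_boundedD:
  "weight_bounded i j c v \<Longrightarrow> coeff2 v (m, s) \<noteq> 0 \<Longrightarrow> m \<le> i \<and> m + 2 * s \<le> i + 2 * j"
  by (auto simp: weight_bounded_def)

lemma weight_bounded_imp_compatible_poly:
  assumes "weight_bounded i j c v" "c \<noteq> 0"
  shows "compatible_poly 0 (1/2) (i, j) v"
proof -
  have "prec_order 0 (1/2) (m, s) (i, j)" if "coeff2 v (m, s) \<noteq> 0" for m s
  proof -
    have "real m \<le> real i" "real (m + 2 * s) \<le> real (i + 2 * j)"
      using weight_boundedD[OF assms(1) that] by (simp_all only: of_nat_le_iff)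
    then show ?thesis by (simp add: prec_order_def)
  qed
  then show ?thesis using assms by (auto simp: compatible_poly_def weight_bounded_def)
qed

lemma coeff2_mult:
  "coeff2 (u * v) (m, s) = (\<Sum>a\<le>m. \<Sum>b\<le>s. coeff2 u (a, b) * coeff2 v (m - a, s - b))"
  by (simp add: coeff2_def coeff_mult coeff_sum)

lemma weight_bounded_mult:
  assumes u: "weight_bounded i j c u" and v: "weight_bounded i' j' c' v"
  shows "weight_bounded (i + i') (j + j') (c * c') (u * v)"
  unfolding weight_bounded_def
proof (intro conjI allI impI)
  \<comment> \<open>The top exponent arises in one way only: if both factors are nonzero, the bounds
    on the first exponents force \<open>a = i\<close>, and then the weighted bounds force
    \<open>b = j\<close>.\<close>
  have z: "coeff2 u (a, b) * coeff2 v (i + i' - a, j + j' - b) = 0"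
    if "a \<le> i + i'" "b \<le> j + j'" "(a, b) \<noteq> (i, j)" for a b
  proof (rule ccontr)
    assume "\<not> ?thesis"
    then have "coeff2 u (a, b) \<noteq> 0" "coeff2 v (i + i' - a, j + j' - b) \<noteq> 0" by auto
    from weight_boundedD[OF u this(1)] weight_boundedD[OF v this(2)] that show False
      by auto
  qed
  have "coeff2 (u * v) (i + i', j + j') =
      (\<Sum>a\<le>i+i'. \<Sum>b\<le>j+j'. if a = i then if b = j then c * c' else 0 else 0)"
    unfolding coeff2_mult
  proof (intro sum.cong refl)
    fix a b assume "a \<in> {..i + i'}" "b \<in> {..j + j'}"
    then show "coeff2 u (a, b) * coeff2 v (i + i' - a, j + j' - b) =
        (if a = i then if b = j then c * c' else 0 else 0)"
      using z[of a b] u v by (cases "(a, b) = (i, j)") (auto simp: weight_bounded_def)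
  qed
  also have "\<dots> = (\<Sum>a\<le>i+i'. if a = i then c * c' else 0)"
    by (intro sum.cong refl) auto
  finally show "coeff2 (u * v) (i + i', j + j') = c * c'" by simp
next
  fix m s
  assume "coeff2 (u * v) (m, s) \<noteq> 0"
  then obtain a b where ab: "a \<le> m" "b \<le> s" "coeff2 u (a, b) * coeff2 v (m - a, s - b) \<noteq> 0"
    unfolding coeff2_mult by (metis (no_types, lifting) atMost_iff sum.not_neutral_contains_not_neutral)
  then have "coeff2 u (a, b) \<noteq> 0" "coeff2 v (m - a, s - b) \<noteq> 0" by auto
  from weight_boundedD[OF u this(1)] weight_boundedD[OF v this(2)] ab(1,2)
  show "m \<le> i + i'" "m + 2 * s \<le> i + i' + 2 * (j + j')" by auto
qed

lemma weight_bounded_diff: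
  assumes "weight_bounded i j c u" "weight_bounded i j c' v"
  shows "weight_bounded i j (c - c') (u - v)"
proof -
  have diff: "coeff2 (u - v) (m, s) = coeff2 u (m, s) - coeff2 v (m, s)" for m s
    by (simp add: coeff2_def)
  then have "coeff2 u (m, s) \<noteq> 0 \<or> coeff2 v (m, s) \<noteq> 0" if "coeff2 (u - v) (m, s) \<noteq> 0" for m s
    using that by auto
  then show ?thesis
    using assms weight_boundedD[OF assms(1)] weight_boundedD[OF assms(2)]
    unfolding weight_bounded_def diff by blast
qed

lemma weight_bounded_const: "weight_bounded 0 0 c [:[:c:]:]"
  by (auto simp: weight_bounded_def coeff2_def coeff_pCons split: nat.splits)

lemma eval2_mult: "eval2 (u * v) a b = eval2 u a b * eval2 v a b"
  and eval2_diff: "eval2 (u - v) a b = eval2 u a b - eval2 v a b"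
  and eval2_const: "eval2 [:[:c:]:] a b = c"
  by (simp_all add: eval2_def)

section \<open>Krawtchouk polynomials\<close>

lemma krawtchouk_0: "krawtchouk 0 x N p = 1"
  by (simp add: krawtchouk_def)

lemma krawtchouk_1: "krawtchouk (Suc 0) x N p = (p - 1) * (N - x) - x"
  by (simp add: krawtchouk_def)

text \<open>Compare coefficients in the differential equation
  \<open>(1 - z) (1 + (p - 1) z) G' = ((p - 1) (N - x) - x - (p - 1) N z) G\<close> satisfied by the generating
  function \<open>G = (1 - z)\<^sup>x (1 + (p - 1) z)\<^bsup>N - x\<^esup>\<close>.\<close>

lemma krawtchouk_recurrence:
  fixes x N p :: real
  shows "real (i + 2) * krawtchouk (Suc (Suc i)) x N p =
    ((p - 1) * (N - x) - x - (p - 2) * real (i + 1)) * krawtchouk (Suc i) x N p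
    - (p - 1) * (N - real i) * krawtchouk i x N p"
proof -
  \<comment> \<open>For real \<open>x\<close> and \<open>N\<close> both factors are binomial series;
    the coefficients of their product \<open>G\<close> are the Krawtchouk values.\<close>
  define A where "A = Abs_fps (\<lambda>l. (-1) ^ l * (x gchoose l))"
  define B where "B = Abs_fps (\<lambda>m. (p - 1) ^ m * ((N - x) gchoose m))"
  define G where "G = A * B"
  have G: "fps_nth G i = krawtchouk i x N p" for i
    by (simp add: G_def A_def B_def fps_mult_nth krawtchouk_def mult_ac)
  have bin: "(1 + real l) * (a gchoose Suc l) = (a - real l) * (a gchoose l)" for a :: real and l
    using gbinomial_mult_1[of a l] by (simp add: algebra_simps)
  have rA: "(1 + real l) * fps_nth A (Suc l) = (real l - x) * fps_nth A l" for l
  proof -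
    have "(1 + real l) * fps_nth A (Suc l) = - ((-1) ^ l * ((1 + real l) * (x gchoose Suc l)))"
      by (simp add: A_def)
    then show ?thesis unfolding bin by (simp add: A_def algebra_simps)
  qed
  have rB: "(1 + real l) * fps_nth B (Suc l) = (p - 1) * (N - x - real l) * fps_nth B l" for l
  proof -
    have "(1 + real l) * fps_nth B (Suc l) = (p - 1) ^ Suc l * ((1 + real l) * (N - x gchoose Suc l))"
      by (simp add: B_def)
    then show ?thesis unfolding bin by (simp add: B_def)
  qed
  have A': "(1 - fps_X) * fps_deriv A = fps_const (- x) * A"
  proof (rule fps_ext)
    fix l show "fps_nth ((1 - fps_X) * fps_deriv A) l = fps_nth (fps_const (- x) * A) l"
      using rA[of l] by (cases l) (simp_all add: left_diff_distrib)
  qed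
  have B': "(1 + fps_const (p - 1) * fps_X) * fps_deriv B = fps_const ((p - 1) * (N - x)) * B"
  proof (rule fps_ext)
    fix l show "fps_nth ((1 + fps_const (p - 1) * fps_X) * fps_deriv B) l
       = fps_nth (fps_const ((p - 1) * (N - x)) * B) l"
      using rB[of l] by (cases l) (simp_all add: algebra_simps)
  qed
  have ODE: "(1 - fps_X) * (1 + fps_const (p - 1) * fps_X) * fps_deriv G =
     (fps_const (- x) * (1 + fps_const (p - 1) * fps_X) +
      fps_const ((p - 1) * (N - x)) * (1 - fps_X)) * G"
  proof -
    have "(1 - fps_X) * (1 + fps_const (p - 1) * fps_X) * fps_deriv G =
       (1 + fps_const (p - 1) * fps_X) * B * ((1 - fps_X) * fps_deriv A) +
       (1 - fps_X) * A * ((1 + fps_const (p - 1) * fps_X) * fps_deriv B)"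
      by (simp add: G_def algebra_simps)
    then show ?thesis unfolding A' B' by (simp only: G_def) (simp only: algebra_simps)
  qed
  \<comment> \<open>Both sides become sums of shifts by \<open>fps_X\<close>, ready for comparison
    of the coefficients at \<open>Suc i\<close>.\<close>
  have lhs: "(1 - fps_X) * (1 + fps_const (p - 1) * fps_X) * fps_deriv G =
     fps_deriv G + fps_const (p - 2) * (fps_X * fps_deriv G)
     - fps_const (p - 1) * (fps_X * (fps_X * fps_deriv G))"
  proof -
    have 2: "fps_const (p - 2) = fps_const (p - 1) - (1 :: real fps)"
      unfolding fps_const_1_eq_1[symmetric] fps_const_sub by simp
    show ?thesis unfolding 2 by (simp only: algebra_simps mult_1_left mult_1_right)
  qed
  have rhs: "(fps_const (- x) * (1 + fps_const (p - 1) * fps_X) +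
      fps_const ((p - 1) * (N - x)) * (1 - fps_X)) * G =
     fps_const ((p - 1) * (N - x) - x) * G - fps_const ((p - 1) * N) * (fps_X * G)"
    unfolding fps_const_sub[symmetric] fps_const_mult[symmetric] fps_const_neg[symmetric]
      fps_const_1_eq_1
    by (simp add: algebra_simps del: fps_const_sub fps_const_mult fps_const_neg fps_const_add)
  have "fps_nth (fps_deriv G + fps_const (p - 2) * (fps_X * fps_deriv G)
      - fps_const (p - 1) * (fps_X * (fps_X * fps_deriv G))) (Suc i) =
     fps_nth (fps_const ((p - 1) * (N - x) - x) * G - fps_const ((p - 1) * N) * (fps_X * G)) (Suc i)"
    using ODE unfolding lhs rhs by simp
  then have "real (i + 2) * fps_nth G (Suc (Suc i)) + (p - 2) * (real (i + 1) * fps_nth G (Suc i))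
      - (p - 1) * (real i * fps_nth G i) =
      ((p - 1) * (N - x) - x) * fps_nth G (Suc i) - (p - 1) * N * fps_nth G i"
    by (cases i) simp_all
  then show ?thesis unfolding G by (simp only: algebra_simps)
qed

text \<open>Since \<open>i > N\<close>, each summand has \<open>l > x\<close> or
  \<open>i - l > N - x\<close>, so one of its binomial coefficients vanishes.\<close>

lemma krawtchouk_eq_0:
  assumes "x \<le> N" "N < i"
  shows "krawtchouk i (real x) (real N) p = 0"
  unfolding krawtchouk_def
proof (intro sum.neutral ballI)
  fix l assume "l \<in> {0..i}"
  have "(x choose l) = 0 \<or> ((N - x) choose (i - l)) = 0"
    using assms by (auto simp: binomial_eq_0_iff)
  moreover have "real x gchoose l = real (x choose l)"
    "real N - real x gchoose (i - l) = real ((N - x) choose (i - l))"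
    using assms by (simp_all add: binomial_gbinomial of_nat_diff)
  ultimately show "(-1) ^ l * (p - 1) ^ (i - l) * (real x gchoose l) *
      (real N - real x gchoose (i - l)) = 0"
    by auto
qed

text \<open>Induction along the recurrence. \<open>X\<close> raises the first degree by one.
  \<open>Y\<close>, standing for \<open>N\<close>, has weight 2 but no \<open>x^2\<close> term, so
  its product with the polynomial for \<open>i\<close> meets the bounds for \<open>i + 2\<close>
  without touching the leading coefficient.\<close>

lemma krawtchouk_weight_bounded:
  assumes X: "weight_bounded 1 0 c X" and Y: "weight_bounded 2 0 0 Y"
    and ev: "\<And>t. t \<in> S \<Longrightarrow> eval2 X (f t) (g t) = (p - 1) * (N t - x t) - x t"
       "\<And>t. t \<in> S \<Longrightarrow> eval2 Y (f t) (g t) = N t"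
  shows "\<exists>v. weight_bounded i 0 (c ^ i / fact i) v \<and>
     (\<forall>t\<in>S. eval2 v (f t) (g t) = krawtchouk i (x t) (N t) p)"
proof (induction i rule: induct_nat_012)
  case 0
  show ?case by (rule exI[of _ "[:[:1:]:]"]) (simp add: weight_bounded_const eval2_const krawtchouk_0)
next
  case 1
  show ?case using X ev by (intro exI[of _ X]) (auto simp: krawtchouk_1)
next
  case (ge2 i)
  then obtain u v where
    u: "weight_bounded i 0 (c ^ i / fact i) u"
      "\<forall>t\<in>S. eval2 u (f t) (g t) = krawtchouk i (x t) (N t) p" and
    v: "weight_bounded (Suc i) 0 (c ^ Suc i / fact (Suc i)) v"
      "\<forall>t\<in>S. eval2 v (f t) (g t) = krawtchouk (Suc i) (x t) (N t) p"
    by blast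
  have const: "weight_bounded 1 0 0 [:[:a:]:]" "weight_bounded 2 0 0 [:[:a:]:]" for a
    by (auto simp: weight_bounded_def coeff2_def coeff_pCons split: nat.splits)
  define w where "w = [:[:1 / real (i + 2):]:] *
     ((X - [:[:(p - 2) * real (i + 1):]:]) * v - [:[:p - 1:]:] * ((Y - [:[:real i:]:]) * u))"
  have 1: "weight_bounded (1 + Suc i) (0 + 0) ((c - 0) * (c ^ Suc i / fact (Suc i)))
      ((X - [:[:(p - 2) * real (i + 1):]:]) * v)"
    by (intro weight_bounded_mult weight_bounded_diff X v const)
  have 2: "weight_bounded (1 + Suc i) (0 + 0) 0 ([:[:p - 1:]:] * ((Y - [:[:real i:]:]) * u))"
    using weight_bounded_mult[OF weight_bounded_const[of "p - 1"]
        weight_bounded_mult[OF weight_bounded_diff[OF Y const(2)[of "real i"]] u(1)]]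
    by simp
  have "weight_bounded (Suc (Suc i)) 0 (1 / real (i + 2) * (c * (c ^ Suc i / fact (Suc i)))) w"
    using weight_bounded_mult[OF weight_bounded_const[of "1 / real (i + 2)"] weight_bounded_diff[OF 1 2]]
    by (simp add: w_def)
  moreover have "1 / real (i + 2) * (c * (c ^ Suc i / fact (Suc i))) =
      c ^ Suc (Suc i) / fact (Suc (Suc i))"
    by (simp add: divide_simps)
  moreover have "eval2 w (f t) (g t) = krawtchouk (Suc (Suc i)) (x t) (N t) p" if "t \<in> S" for t
  proof -
    have "eval2 u (f t) (g t) = krawtchouk i (x t) (N t) p"
      "eval2 v (f t) (g t) = krawtchouk (Suc i) (x t) (N t) p"
      using u(2) v(2) that by auto
    then have "eval2 w (f t) (g t) =
        1 / real (i + 2) * (real (i + 2) * krawtchouk (Suc (Suc i)) (x t) (N t) p)"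
      unfolding krawtchouk_recurrence
      by (simp only: w_def eval2_mult eval2_diff eval2_const ev[OF that] mult.assoc)
    then show ?thesis by simp
  qed
  ultimately show ?case by (intro exI[of _ w]) auto
qed

section \<open>Hahn polynomials\<close>

text \<open>The two top terms come from \<open>(z - 1)^m = z^m - m z^(m - 1) + ...\<close>. As
  \<open>m\<close> is only an upper bound on the degree, the lemma also yields vanishing
  coefficients above the degree.\<close>

lemma coeff_backward_shift:
  fixes p :: "real poly"
  assumes "degree p \<le> m"
  shows "coeff (pcompose p [:-1, 1:]) m = coeff p m \<and>
    (\<forall>m'. m = Suc m' \<longrightarrow> coeff (pcompose p [:-1, 1:]) m' = coeff p m' - real m * coeff p m)"
  using assms
proof (induction p arbitrary: m)
  case 0
  then show ?case by simp
next
  case (pCons a p)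
  show ?case
  proof (cases "p = 0")
    case True
    then show ?thesis by (auto simp: pcompose_pCons coeff_pCons split: nat.splits)
  next
    case False
    with pCons.prems obtain m' where m: "m = Suc m'" "degree p \<le> m'"
      by (cases m) auto
    have z: "coeff p (Suc m') = 0" using m by (simp add: coeff_eq_0)
    have 1: "coeff (pcompose p [:-1, 1:]) (Suc m') = 0"
      using pCons.IH[of "Suc m'"] m z by simp
    have 2: "coeff (pcompose p [:-1, 1:]) m' = coeff p m'"
      using pCons.IH[of m'] m by simp
    show ?thesis
    proof (cases m')
      case 0
      then show ?thesis using 1 2 m by (simp add: pcompose_pCons)
    next
      case (Suc m'')
      then have "coeff (pcompose p [:-1, 1:]) m'' = coeff p m'' - real m' * coeff p m'"
        using pCons.IH[of m'] m by simp
      then show ?thesis using 1 2 m Suc by (simp add: pcompose_pCons algebra_simps)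
    qed
  qed
qed

lemma eberlein_0: "eberlein y 0 (a + b) a = (a gchoose y) * (b gchoose y)"
proof -
  have "eberlein y 0 (a + b) a = (\<Sum>l=0..y. if l = 0 then (a gchoose y) * (b gchoose y) else 0)"
    unfolding eberlein_def by (intro sum.cong refl) (auto simp: gr0_conv_Suc gbinomial_0)
  then show ?thesis by simp
qed

text \<open>The Eberlein sum is the \<open>j\<close>-th backward difference of the product of the binomial
  coefficients \<open>a gchoose y\<close> and \<open>b gchoose y\<close> (a Rodrigues formula); each difference raises
  \<open>a\<close>, \<open>b\<close> and the degree of the cofactor by one.\<close>

lemma eberlein_rodrigues:
  fixes a b :: real
  assumes "a \<ge> 0" "b \<ge> 0"
  shows "\<exists>P. degree P = j \<and> P \<noteq> 0 \<and> (\<forall>y. eberlein y (real j) (a + b + 2 * real j) (a + real j) =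
     ((a + real j) gchoose y) * ((b + real j) gchoose y) * poly P (real y))"
proof (induction j)
  case 0
  show ?case by (intro exI[of _ 1]) (simp add: eberlein_0)
next
  case (Suc j)
  define F where "F j y = eberlein y (real j) (a + b + 2 * real j) (a + real j)" for j y
  \<comment> \<open>With these parameters the shifts by \<open>real j\<close> cancel:
    \<open>j\<close> enters only through \<open>real j gchoose l\<close>.\<close>
  have F: "F j y = (\<Sum>l=0..y. (-1) ^ l * (real j gchoose l) * (a gchoose (y - l)) * (b gchoose (y - l)))"
    for j y
  proof -
    have "a + real j - real j = a" "a + b + 2 * real j - (a + real j) - real j = b" by simp_all
    then show ?thesis unfolding F_def eberlein_def by simp
  qed
  have F0: "F (Suc j) 0 = F j 0" by (simp add: F)
  \<comment> \<open>Pascal's rule for \<open>real j + 1\<close> turns the sum into a backward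
    difference in \<open>y\<close>.\<close>
  have FS: "F (Suc j) (Suc y) = F j (Suc y) - F j y" for y
  proof -
    have "1 + real j gchoose Suc l = (real j gchoose l) + (real j gchoose Suc l)" for l
      using gbinomial_Suc_Suc[of "real j" l] by (simp add: add.commute)
    then show ?thesis
      unfolding F sum.atLeast0_atMost_Suc_shift
      by (simp add: algebra_simps sum.distrib sum_negf sum_subtractf)
  qed
  obtain P where P: "degree P = j" "P \<noteq> 0"
    "\<And>y. F j y = ((a + real j) gchoose y) * ((b + real j) gchoose y) * poly P (real y)"
    using Suc unfolding F_def by auto
  define A B where "A = a + real j" and "B = b + real j"
  have AB: "A + 1 > 0" "B + 1 > 0" using assms by (auto simp: A_def B_def)
  \<comment> \<open>\<open>M\<close> and \<open>Q\<close> result from writing both terms of the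
    difference over \<open>(A + 1) gchoose y\<close> and \<open>(B + 1) gchoose y\<close>, by the
    absorption identities \<open>up\<close> and \<open>down\<close> below.\<close>
  define M where "M = [:A + 1, -1:] * [:B + 1, -1:] * P - [:0, 0, 1:] * pcompose P [:-1, 1:]"
  define Q where "Q = smult (1 / ((A + 1) * (B + 1))) M"
  have pQ: "poly Q y = ((A + 1 - y) * (B + 1 - y) * poly P y - y\<^sup>2 * poly P (y - 1)) / ((A + 1) * (B + 1))" for y
    by (simp only: Q_def M_def poly_smult poly_diff poly_mult poly_pcompose)
      (simp add: power2_eq_square)
  have up: "c gchoose y = ((c + 1) gchoose y) * (c + 1 - real y) / (c + 1)" if "c + 1 > 0" for c y
    using gbinomial_absorb_comp[of "c + 1" y] that by (simp add: field_simps)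
  have down: "c gchoose y = ((c + 1) gchoose Suc y) * real (Suc y) / (c + 1)" if "c + 1 > 0" for c y
    using gbinomial_factors[of c y] that by (simp add: field_simps)
  have main: "F (Suc j) y = ((A + 1) gchoose y) * ((B + 1) gchoose y) * poly Q (real y)" for y
  proof (cases y)
    \<comment> \<open>At \<open>y = 0\<close> there is no preceding value, and the shifted term in
      \<open>Q\<close> carries the factor \<open>y^2 = 0\<close>.\<close>
    case 0
    then show ?thesis using F0 P(3)[of 0] AB by (simp add: pQ)
  next
    case (Suc z)
    have "F (Suc j) y = (A gchoose y) * (B gchoose y) * poly P (real y) -
        (A gchoose z) * (B gchoose z) * poly P (real z)"
      unfolding Suc FS P(3) A_def B_def ..
    also have "\<dots> = ((A + 1) gchoose y) * ((B + 1) gchoose y) * poly Q (real y)"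
    proof -
      have alg: "(U * (\<alpha> - t) / \<alpha>) * (V * (\<beta> - t) / \<beta>) * e - (U * t / \<alpha>) * (V * t / \<beta>) * f =
          U * V * (((\<alpha> - t) * (\<beta> - t) * e - t\<^sup>2 * f) / (\<alpha> * \<beta>))"
        if "\<alpha> > 0" "\<beta> > 0" for U V \<alpha> \<beta> t e f :: real
        using that by (simp add: field_simps power2_eq_square)
      have "real z = real y - 1" using Suc by simp
      then show ?thesis
        unfolding up[OF AB(1), of y] up[OF AB(2), of y] down[OF AB(1), of z] down[OF AB(2), of z]
          pQ Suc[symmetric]
        using alg[OF AB] by simp
    qed
    finally show ?thesis .
  qed
  \<comment> \<open>Regrouping cancels the terms of degree \<open>j + 2\<close>. For
    \<open>j > 0\<close> the difference of \<open>P\<close> has leading term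
    \<open>j * lead_coeff P\<close> in degree \<open>j - 1\<close>, which gives the coefficient of
    \<open>M\<close> in degree \<open>j + 1\<close> below; it is nonzero because
    \<open>A + B \<ge> 2 * j\<close>.\<close>
  have M: "M = [:(A + 1) * (B + 1), - (A + B + 2):] * P + [:0, 0, 1:] * (P - pcompose P [:-1, 1:])"
    by (simp add: M_def algebra_simps)
  have c1: "coeff M (Suc j) = (real j - (A + B + 2)) * lead_coeff P"
  proof (cases j)
    case 0
    then show ?thesis using P(1) by (simp add: M coeff_eq_0)
  next
    case (Suc i)
    then show ?thesis using coeff_backward_shift[of P j] P(1)
      by (simp add: M coeff_eq_0 algebra_simps)
  qed
  have "real j - (A + B + 2) \<noteq> 0" using assms by (simp add: A_def B_def)
  then have c1: "coeff M (Suc j) \<noteq> 0" using c1 P(2) by simp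
  have "coeff M m = 0" if "m > Suc j" for m
  proof -
    define i where "i = m - 2"
    have "m = Suc (Suc i)" "i \<ge> j" using that by (auto simp: i_def)
    then show ?thesis using coeff_backward_shift[of P i] P(1)
      by (simp add: M coeff_eq_0)
  qed
  then have "degree M \<le> Suc j" by (intro degree_le) auto
  with le_degree[OF c1] have "degree M = Suc j" by simp
  then have "degree Q = Suc j" using AB by (simp add: Q_def)
  moreover from this have "Q \<noteq> 0" by auto
  ultimately show ?case
    using main by (intro exI[of _ Q]) (auto simp: F_def A_def B_def add_ac)
qed

section \<open>The bivariate Q-polynomial structure\<close>

text \<open>Adding \<open>m \<le> i\<close> to \<open>m + 2 * s \<le> i + 2 * j\<close> gives
  \<open>m + s \<le> k\<close>. As \<open>n - k \<ge> k - 1\<close>, the bound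
  \<open>s \<le> n - k\<close> could fail only for \<open>s = k = n - k + 1\<close>; then
  \<open>2 * k \<le> i + 2 * j \<le> k + j\<close> forces \<open>j \<ge> k\<close>, against
  \<open>j \<le> n - k\<close>.\<close>

lemma johnson_region_compatible:
  assumes "k \<le> n" "n \<ge> 2 * k - 1"
  shows "compatible_region 0 (1/2) (johnson_region k n)"
  unfolding compatible_region_def
proof (intro ballI allI impI)
  fix d d' assume d: "d \<in> johnson_region k n" and prec: "prec_order 0 (1/2) d' d"
  obtain i j m s where eq: "d = (i, j)" "d' = (m, s)" by (cases d, cases d')
  have "real m \<le> real i" "real (m + 2 * s) \<le> real (i + 2 * j)"
    using prec by (simp_all add: eq prec_order_def)
  then have "m \<le> i" "m + 2 * s \<le> i + 2 * j" by (simp_all only: of_nat_le_iff)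
  then show "d' \<in> johnson_region k n"
    using d assms by (auto simp: eq johnson_region_def)
qed

section \<open>The Hahn factor as a polynomial in \<open>y\<close>\<close>

lemma hahn_0:
  assumes "y \<le> p" "y \<le> q"
  shows "hahn 0 y (real p + real q) (real p) = 1"
  using assms
  by (simp add: hahn_def eberlein_0 binomial_gbinomial[symmetric])

text \<open>For \<open>j = i + 1\<close>, multiplying the difference by \<open>i + 1\<close> gives
  \<open>(N - 2 * i - 1) * (N gchoose i)\<close>, and \<open>2 * j \<le> N\<close> keeps both
  factors nonzero.\<close>

lemma gbinomial_diff_neq_0:
  assumes "2 * j \<le> N"
  shows "(real N gchoose j) - (if j = 0 then 0 else real N gchoose (j - 1)) \<noteq> 0"
proof (cases j)
  case (Suc i)
  have "real (N choose i) \<noteq> 0" using assms Suc by simp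
  then have pos: "real N gchoose i \<noteq> 0" by (simp add: binomial_gbinomial)
  have "real (Suc i) * ((real N gchoose Suc i) - (real N gchoose i)) =
      (real N - 2 * real i - 1) * (real N gchoose i)"
    using gbinomial_mult_1[of "real N" i] by (simp add: algebra_simps)
  moreover have "real N - 2 * real i - 1 \<noteq> 0" using assms Suc by simp
  ultimately have "(real N gchoose Suc i) - (real N gchoose i) \<noteq> 0" using pos by auto
  then show ?thesis using Suc by simp
qed simp

text \<open>This is the Rodrigues form with \<open>a = p - j\<close> and \<open>b = q - j\<close>:
  for \<open>y\<close> at most \<open>p\<close> and \<open>q\<close> its binomial coefficients are
  nonzero and cancel the denominator.\<close>

lemma hahn_polynomial:
  assumes "j \<le> p" "j \<le> q"
  obtains P where "degree P = j" "P \<noteq> 0"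
    "\<And>y. y \<le> p \<Longrightarrow> y \<le> q \<Longrightarrow> hahn j y (real p + real q) (real p) = poly P (real y)"
proof -
  obtain P where P: "degree P = j" "P \<noteq> 0"
    "\<And>y. eberlein y (real j) (real p + real q) (real p) = (real p gchoose y) * (real q gchoose y) * poly P (real y)"
    using eberlein_rodrigues[of "real p - real j" "real q - real j" j] assms by auto
  define C where "C = (real (p + q) gchoose j) - (if j = 0 then 0 else real (p + q) gchoose (j - 1))"
  have C: "C \<noteq> 0" unfolding C_def by (rule gbinomial_diff_neq_0) (use assms in simp)
  have "hahn j y (real p + real q) (real p) = poly (smult C P) (real y)" if "y \<le> p" "y \<le> q" for y
  proof -
    have "real (p choose y) \<noteq> 0" "real (q choose y) \<noteq> 0" using that by simp_all
    then have "real p gchoose y \<noteq> 0" "real q gchoose y \<noteq> 0"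
      by (simp_all only: binomial_gbinomial not_False_eq_True)
    then show ?thesis unfolding hahn_def P(3) by (simp add: C_def)
  qed
  then show thesis using that[of "smult C P"] P C by simp
qed

section \<open>The dual eigenvalues as polynomials in those at (1, 0) and (0, 1)\<close>

lemma johnson_q_00:
  assumes "k \<le> n" "t \<in> johnson_region k n"
  shows "johnson_q r k n (0, 0) t = 1"
  using assms hahn_0[of "snd t" k "n - k"]
  by (auto simp: johnson_q_def krawtchouk_0 johnson_region_def)

lemma johnson_q_10:
  assumes "k > 0" "k \<le> n" "(x, y) \<in> johnson_region k n"
  shows "johnson_q r k n (1, 0) (x, y) =
    real n / real k * ((real r - 2) * (real k - real y - real x) - real x)"
proof (cases "y = k")
  \<comment> \<open>Here \<open>x = 0\<close>, so the Krawtchouk factor and the right-hand side both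
    vanish, whatever the Hahn factor is.\<close>
  case True
  then show ?thesis using assms by (simp add: johnson_q_def krawtchouk_1 johnson_region_def)
next
  case False
  then have "hahn 0 y (real n - 1) (real k - 1) = 1"
    using hahn_0[of y "k - 1" "n - k"] assms by (auto simp: johnson_region_def of_nat_diff)
  then show ?thesis using assms by (simp add: johnson_q_def krawtchouk_1)
qed

lemma johnson_q_polynomial:
  assumes "k > 0" "k < n" and ij: "(i, j) \<in> johnson_region k n"
  shows "\<exists>v. compatible_poly 0 (1/2) (i, j) v \<and> (\<forall>t\<in>johnson_region k n.
    johnson_q r k n (i, j) t = eval2 v (johnson_q r k n (1, 0) t) (johnson_q r k n (0, 1) t))"
proof -
  define \<alpha> where "\<alpha> = real n / real k"
  have \<alpha>: "\<alpha> \<noteq> 0" using assms by (simp add: \<alpha>_def)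
  \<comment> \<open>\<open>0 < k < n\<close> allows degree 1, so the value at (0, 1) is affine in
    \<open>y\<close> with nonzero slope.\<close>
  obtain B where B: "degree B = 1"
    "\<And>y. y \<le> k \<Longrightarrow> y \<le> n - k \<Longrightarrow> hahn 1 y (real k + real (n - k)) (real k) = poly B (real y)"
    by (rule hahn_polynomial[of 1 k "n - k"]) (use assms(1,2) in simp_all)
  define \<beta>\<^sub>0 \<beta>\<^sub>1 where "\<beta>\<^sub>0 = coeff B 0" and "\<beta>\<^sub>1 = coeff B 1"
  have \<beta>: "\<beta>\<^sub>1 \<noteq> 0" using B(1) by (metis \<beta>\<^sub>1_def degree_0 leading_coeff_0_iff zero_neq_one)
  have pB: "poly B z = \<beta>\<^sub>0 + \<beta>\<^sub>1 * z" for z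
    using B(1) by (simp add: poly_altdef \<beta>\<^sub>0_def \<beta>\<^sub>1_def)
  have q01: "johnson_q r k n (0, 1) (x, y) = \<beta>\<^sub>0 + \<beta>\<^sub>1 * real y"
    if "(x, y) \<in> johnson_region k n" for x y
    using that B(2)[of y] assms
    by (simp add: johnson_q_def krawtchouk_0 johnson_region_def pB of_nat_diff)
  obtain P where P: "degree P = j" "P \<noteq> 0"
    "\<And>y. y \<le> k - i \<Longrightarrow> y \<le> n - k \<Longrightarrow>
      hahn j y (real (k - i) + real (n - k)) (real (k - i)) = poly P (real y)"
  proof -
    have "j \<le> k - i" "j \<le> n - k" using ij by (auto simp: johnson_region_def)
    from hahn_polynomial[OF this] that show thesis .
  qed
  define C where "C = (real n gchoose i) / (real k gchoose i)"
  have "real (n choose i) \<noteq> 0" "real (k choose i) \<noteq> 0"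
    using ij assms by (auto simp: johnson_region_def)
  then have C: "C \<noteq> 0" by (simp add: C_def binomial_gbinomial)

  \<comment> \<open>\<open>L\<close> recovers \<open>y\<close> from the value at (0, 1). Thus
    \<open>X\<close> evaluates to the linear Krawtchouk expression, \<open>Y\<close> to
    \<open>k - y\<close> and \<open>Z\<close> to \<open>poly P y\<close>.\<close>
  define L where "L = [:- \<beta>\<^sub>0 / \<beta>\<^sub>1, 1 / \<beta>\<^sub>1:]"
  have L: "poly L (\<beta>\<^sub>0 + \<beta>\<^sub>1 * z) = z" for z using \<beta> by (simp add: L_def field_simps)
  define X where "X = [:0, [:1 / \<alpha>:]:]"
  define Y where "Y = [:[:real k:] - L:]"
  define Z where "Z = [:pcompose P L:]"
  have X: "weight_bounded 1 0 (1 / \<alpha>) X"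
    by (auto simp: X_def weight_bounded_def coeff2_def coeff_pCons split: nat.splits)
  have Y: "weight_bounded 2 0 0 Y"
    by (auto simp: Y_def L_def weight_bounded_def coeff2_def coeff_pCons numeral_2_eq_2 split: nat.splits)
  have degL: "degree L = 1" using \<beta> by (simp add: L_def)
  have degZ: "degree (pcompose P L) = j" by (simp add: degree_pcompose P(1) degL)
  have lead: "coeff (pcompose P L) j \<noteq> 0"
  proof -
    have "lead_coeff L \<noteq> 0" using \<beta> by (simp add: L_def)
    then show ?thesis using lead_coeff_comp[of L P] P(2) degL by (simp add: degZ)
  qed
  have Z: "weight_bounded 0 j (coeff (pcompose P L) j) Z"
    using le_degree[of "pcompose P L"] degZ
    by (auto simp: Z_def weight_bounded_def coeff2_def coeff_pCons split: nat.splits)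

  let ?f = "johnson_q r k n (1, 0)" and ?g = "johnson_q r k n (0, 1)"
  have evX: "eval2 X (?f t) (?g t) =
      (real r - 1 - 1) * (real k - real (snd t) - real (fst t)) - real (fst t)"
    if "t \<in> johnson_region k n" for t
    using that \<alpha> assms johnson_q_10[of k n "fst t" "snd t" r]
    by (simp add: X_def eval2_def \<alpha>_def)
  have evY: "eval2 Y (?f t) (?g t) = real k - real (snd t)" if "t \<in> johnson_region k n" for t
    using that q01[of "fst t" "snd t"] L by (simp add: Y_def eval2_def)
  obtain K where K: "weight_bounded i 0 ((1 / \<alpha>) ^ i / fact i) K"
    "\<forall>t\<in>johnson_region k n. eval2 K (?f t) (?g t) =
       krawtchouk i (real (fst t)) (real k - real (snd t)) (real r - 1)"
    using krawtchouk_weight_bounded[OF X Y, where f = ?f and g = ?g and i = i and p = "real r - 1"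
        and x = "\<lambda>t. real (fst t)" and N = "\<lambda>t. real k - real (snd t)" and S = "johnson_region k n"]
      evX evY by auto
  define v where "v = [:[:C:]:] * (K * Z)"
  have "weight_bounded i j (C * ((1 / \<alpha>) ^ i / fact i * coeff (pcompose P L) j)) v"
    using weight_bounded_mult[OF weight_bounded_const[of C] weight_bounded_mult[OF K(1) Z]]
    by (simp add: v_def)
  then have "compatible_poly 0 (1/2) (i, j) v"
    by (rule weight_bounded_imp_compatible_poly) (use C \<alpha> lead in simp)
  moreover have "johnson_q r k n (i, j) t = eval2 v (?f t) (?g t)" if t: "t \<in> johnson_region k n" for t
  proof -
    obtain x y where xy: "t = (x, y)" by (cases t)
    have "eval2 Z (?f t) (?g t) = poly P (real y)"
      using t q01[of x y] L by (simp add: Z_def eval2_def poly_pcompose xy)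
    then have ev: "eval2 v (?f t) (?g t) =
        C * (krawtchouk i (real x) (real k - real y) (real r - 1) * poly P (real y))"
      using K(2) t by (auto simp only: v_def eval2_mult eval2_const xy fst_conv snd_conv)
    show ?thesis
    proof (cases "y \<le> k - i")
      case True
      have "hahn j y (real n - real i) (real k - real i) = poly P (real y)"
        using P(3)[OF True] t ij assms by (simp add: johnson_region_def xy of_nat_diff)
      then show ?thesis unfolding ev by (simp add: johnson_q_def xy C_def)
    next
      \<comment> \<open>\<open>P\<close> need not represent the Hahn factor here, but
        \<open>x \<le> k - y < i\<close> makes the Krawtchouk factor zero.\<close>
      case False
      have "krawtchouk i (real x) (real k - real y) (real r - 1) = 0"
      proof -
        have "x \<le> k - y" "k - y < i" "y \<le> k" using t ij False by (auto simp: johnson_region_def xy)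
        then show ?thesis using krawtchouk_eq_0[of x "k - y" i "real r - 1"] by (simp add: of_nat_diff)
      qed
      then show ?thesis unfolding ev by (simp add: johnson_q_def xy)
    qed
  qed
  ultimately show ?thesis by blast
qed

theorem mainTheorem1:
  fixes r k n :: nat
    and E :: "nat \<times> nat \<Rightarrow> (nat \<Rightarrow> nat) \<Rightarrow> (nat \<Rightarrow> nat) \<Rightarrow> real"
  assumes "r \<ge> 3" and "k > 0" and "n > 0" and "k \<le> n" and "n \<ge> 2 * k - 1"
    and labeling: "bij_betw E (johnson_region k n)
      (primitive_idempotents (johnson_points r k n) (johnson_region k n) (johnson_rel r k n))"
    and formula: "\<And>d. d \<in> johnson_region k n \<Longrightarrow>
      E d = (\<lambda>x y. 1 / real (card (johnson_points r k n)) *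
        (\<Sum>d'\<in>johnson_region k n. johnson_q r k n d d' * adjacency (johnson_rel r k n) d' x y))"
  shows "bivariate_Q_polynomial 0 (1/2) (johnson_points r k n) (johnson_region k n)
    (johnson_rel r k n) (johnson_region k n) E"
proof -
  let ?X = "johnson_points r k n" and ?D = "johnson_region k n"
  have scheme: "symmetric_association_scheme ?X ?D (johnson_rel r k n)"
    by (rule johnson_scheme) fact+
  then have "real (card ?X) \<noteq> 0"
    by (simp add: symmetric_association_scheme_def)
  have entry: "real (card ?X) * E d x y = johnson_q r k n d t"
    if "d \<in> ?D" "t \<in> ?D" "(x, y) \<in> johnson_rel r k n t" for d t x y
  proof -
    have "real (card ?X) * E d x y =
        (\<Sum>d'\<in>?D. johnson_q r k n d d' * adjacency (johnson_rel r k n) d' x y)"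
      using \<open>real (card ?X) \<noteq> 0\<close> by (simp add: formula[OF that(1)])
    \<comment> \<open>The relations are disjoint, so only the one containing \<open>(x, y)\<close>
      contributes.\<close>
    also have "\<dots> = (\<Sum>d'\<in>?D. if d' = t then johnson_q r k n d t else 0)"
      by (intro sum.cong refl) (use that johnson_rel_unique in \<open>auto simp: adjacency_def\<close>)
    finally show ?thesis using that(2) finite_johnson_region by simp
  qed
  have "\<exists>v. compatible_poly 0 (1/2) d v \<and> (\<forall>x\<in>?X. \<forall>y\<in>?X. real (card ?X) * E d x y =
      eval2 v (real (card ?X) * E (1, 0) x y) (real (card ?X) * E (0, 1) x y))"
    if d: "d \<in> ?D" for d
  proof (cases "k < n")
    case True
    then have mem: "(1, 0) \<in> ?D" "(0, 1) \<in> ?D" using assms by (auto simp: johnson_region_def)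
    obtain v where v: "compatible_poly 0 (1/2) d v" "\<forall>t\<in>?D.
        johnson_q r k n d t = eval2 v (johnson_q r k n (1, 0) t) (johnson_q r k n (0, 1) t)"
      using johnson_q_polynomial[of k n "fst d" "snd d" r] True assms d by auto
    moreover have "real (card ?X) * E d x y =
        eval2 v (real (card ?X) * E (1, 0) x y) (real (card ?X) * E (0, 1) x y)"
      if xy: "x \<in> ?X" "y \<in> ?X" for x y
    proof -
      obtain t where t: "t \<in> ?D" "(x, y) \<in> johnson_rel r k n t"
        using johnson_rel_cover[OF \<open>k \<le> n\<close> xy] .
      show ?thesis using v(2) t(1) by (simp only: entry[OF d t] entry[OF mem(1) t] entry[OF mem(2) t])
    qed
    ultimately show ?thesis by blast
  next
    \<comment> \<open>Here \<open>k = n = 1\<close>, so \<open>(0, 1)\<close> lies outside the region and \<open>E (0, 1)\<close> is unconstrained.\<close>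
    case False
    then have kn: "k = 1" "n = 1" using assms by auto
    then consider "d = (0, 0)" | "d = (1, 0)" using d by (force simp: johnson_region_def)
    then show ?thesis
    proof cases
      case 1
      have "compatible_poly 0 (1/2) d [:[:1:]:]"
        unfolding 1 by (rule weight_bounded_imp_compatible_poly[OF weight_bounded_const]) simp
      moreover have "real (card ?X) * E d x y = 1" if xy: "x \<in> ?X" "y \<in> ?X" for x y
      proof -
        obtain t where t: "t \<in> ?D" "(x, y) \<in> johnson_rel r k n t"
          using johnson_rel_cover[OF \<open>k \<le> n\<close> xy] .
        show ?thesis unfolding entry[OF d t] unfolding 1 by (rule johnson_q_00[OF \<open>k \<le> n\<close> t(1)])
      qed
      ultimately show ?thesis by (intro exI[of _ "[:[:1:]:]"]) (simp add: eval2_const)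
    next
      case 2
      have "weight_bounded 1 0 1 [:0, 1:]"
        by (auto simp: weight_bounded_def coeff2_def coeff_pCons split: nat.splits)
      then have "compatible_poly 0 (1/2) d [:0, 1:]"
        unfolding 2 by (rule weight_bounded_imp_compatible_poly) simp
      then show ?thesis by (intro exI[of _ "[:0, 1:]"]) (simp add: eval2_def 2)
    qed
  qed
  then show ?thesis
    unfolding bivariate_Q_polynomial_def
    using scheme labeling johnson_region_compatible[OF \<open>k \<le> n\<close> \<open>n \<ge> 2 * k - 1\<close>] by simp
qed

end
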